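(* Let $K$ be a space equipped with a measure $\mu$ and with the effective resistance metric $d$ associated to a Dirichlet form $\mathcal{E}$. Assume that there exist positive constants $b, C_0, C_1, C_2$ such that for all $x\in K$ and all $0<r<C_0$ $$C_1 r^b\leq \mu(B_r(x))\leq C_2 r^b .$$ Let $\gamma=b+1$. Then there exists a constant $C>0$ such that for all $u\in \mathcal{D}om(\mathcal{E})$ with $\|u\|_{2}=1$ one has $$Var_\gamma(u)\,\bigl(\mathcal{E}(u,u)+1\bigr)\geq C.$$
   Context: $(K,d)$ is a metric space equipped with a Borel measure $\mu$, and $\mathcal{E}$ is a Dirichlet form with domain $\mathcal{D}om(\mathcal{E})\subset L^2(K,\mu)$. By convention, $\|u\|_2=\infty$ if $u$ is not square integrable and $\mathcal{E}(u,u)=\infty$ if $u\notin\mathcal{D}om(\mathcal{E})$. It is assumed that $d$ is the effective resistance metric associated to $\mathcal{E}$, i.e. that $$d(x,y)=\sup \mathcal{E}(u,u)^{-1},$$ where the supremum is over all continuous functions $u$ with $u(x)=1$, $u(y)=0$ (in particular this quantity is assumed to be finite); in this setting $\mathcal{E}$ is also called a resistance form (in the sense of Kigami, "Harmonic analysis for resistance forms"). $B_r(x)$ denotes the ball with center $x$ and radius $r$ in the metric $d$. The norm $\|\cdot\|_2$ is the norm of $L^2(K,\mu)$. The spatial variance is $$Var_\gamma(u)=\iint_{K\times K}d(x,y)^\gamma |u(x)|^2|u(y)|^2\,d\mu(x)\,d\mu(y).$$ The constant $C$ does not depend on $u$.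
   Formalization: Every function in Dom(E) is assumed to agree almost everywhere with a continuous one, as holds for Kigami's resistance forms; the sup formula for d alone does not imply this, and without it the claim fails (e.g. [0,1] cut at the points 1/n). *)

theory Defs
  imports "HOL-Analysis.Analysis"
begin

definition square_integrable :: "'a measure \<Rightarrow> ('a \<Rightarrow> real) set" where
  "square_integrable M = {u \<in> borel_measurable M. integrable M (\<lambda>x. (u x)\<^sup>2)}"

definition l2_norm :: "'a measure \<Rightarrow> ('a \<Rightarrow> real) \<Rightarrow> ennreal" where
  "l2_norm M u =
     (if u \<in> square_integrable M then ennreal (sqrt (LINT x|M. (u x)\<^sup>2)) else \<infinity>)"

text \<open>
  A (symmetric, real) Dirichlet form on $L^2(M)$: a densely defined, nonnegative, symmetric
  bilinear form that is closed and Markovian. Elements of $L^2(M)$ are represented by functions;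
  the two \<open>AE\<close> axioms say that the domain and the form only depend on the
  equivalence class modulo equality almost everywhere. The values of \<open>E\<close> outside the domain
  \<open>D\<close> are irrelevant.
\<close>

locale dirichlet_form =
  fixes M :: "'a measure"
    and D :: "('a \<Rightarrow> real) set"
    and E :: "('a \<Rightarrow> real) \<Rightarrow> ('a \<Rightarrow> real) \<Rightarrow> real"
  assumes dom_square_integrable: "D \<subseteq> square_integrable M"
    and dom_AE: "\<And>u v. u \<in> D \<Longrightarrow> v \<in> borel_measurable M \<Longrightarrow> (AE x in M. u x = v x) \<Longrightarrow> v \<in> D"
    and form_AE: "\<And>u v w. u \<in> D \<Longrightarrow> v \<in> D \<Longrightarrow> w \<in> D \<Longrightarrow> (AE x in M. u x = v x)
          \<Longrightarrow> E u w = E v w"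
    and dom_zero: "(\<lambda>x. 0) \<in> D"
    and dom_add: "\<And>u v. u \<in> D \<Longrightarrow> v \<in> D \<Longrightarrow> (\<lambda>x. u x + v x) \<in> D"
    and dom_scale: "\<And>c u. u \<in> D \<Longrightarrow> (\<lambda>x. c * u x) \<in> D"
    and dom_dense: "\<And>f e. f \<in> square_integrable M \<Longrightarrow> e > 0
          \<Longrightarrow> \<exists>u\<in>D. l2_norm M (\<lambda>x. f x - u x) < ennreal e"
    and form_add: "\<And>u v w. u \<in> D \<Longrightarrow> v \<in> D \<Longrightarrow> w \<in> D
          \<Longrightarrow> E (\<lambda>x. u x + v x) w = E u w + E v w"
    and form_scale: "\<And>c u w. u \<in> D \<Longrightarrow> w \<in> D \<Longrightarrow> E (\<lambda>x. c * u x) w = c * E u w"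
    and form_sym: "\<And>u v. u \<in> D \<Longrightarrow> v \<in> D \<Longrightarrow> E u v = E v u"
    and form_nonneg: "\<And>u. u \<in> D \<Longrightarrow> 0 \<le> E u u"
    and form_closed: "\<And>U. (\<And>n. U n \<in> D) \<Longrightarrow>
          (\<And>e. e > 0 \<Longrightarrow> \<exists>N. \<forall>m\<ge>N. \<forall>n\<ge>N.
             E (\<lambda>x. U m x - U n x) (\<lambda>x. U m x - U n x) + (LINT x|M. (U m x - U n x)\<^sup>2) < e)
          \<Longrightarrow> \<exists>u\<in>D. (\<lambda>n::nat. E (\<lambda>x. U n x - u x) (\<lambda>x. U n x - u x)
                 + (LINT x|M. (U n x - u x)\<^sup>2)) \<longlonglongrightarrow> 0"
    and form_markov: "\<And>u. u \<in> D \<Longrightarrow> (\<lambda>x. min 1 (max 0 (u x))) \<in> D \<and>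
          E (\<lambda>x. min 1 (max 0 (u x))) (\<lambda>x. min 1 (max 0 (u x))) \<le> E u u"

definition energy ::
  "('a \<Rightarrow> real) set \<Rightarrow> (('a \<Rightarrow> real) \<Rightarrow> ('a \<Rightarrow> real) \<Rightarrow> real) \<Rightarrow> ('a \<Rightarrow> real) \<Rightarrow> ennreal"
where
  "energy D E u = (if u \<in> D then ennreal (E u u) else \<infinity>)"

text \<open>
  In \<open>ennreal\<close> one has \<open>inverse 0 = \<infinity>\<close> and \<open>inverse \<infinity> = 0\<close>, so functions outside the
  domain do not contribute, and the supremum of the empty set (the case \<open>x = y\<close>) is \<open>0\<close>.
\<close>

definition effective_resistance ::
  "('a::topological_space \<Rightarrow> real) set \<Rightarrow> (('a \<Rightarrow> real) \<Rightarrow> ('a \<Rightarrow> real) \<Rightarrow> real)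
     \<Rightarrow> 'a \<Rightarrow> 'a \<Rightarrow> ennreal"
where
  "effective_resistance D E x y =
     (SUP u\<in>{u. continuous_on UNIV u \<and> u x = 1 \<and> u y = 0}. inverse (energy D E u))"

text \<open>
  A metric space with a Borel measure and a Dirichlet form whose effective resistance metric is
  the given (finite) metric. The axiom \<open>dom_continuous\<close> expresses that the form is a resistance
  form, i.e. that its domain consists of continuous functions (up to null sets). The formula for
  the metric tests only continuous functions, hence does not imply it: splitting $[0,1]$ at the
  points $1/n$ and letting the domain be the direct sum of the spaces $H^1$ of the pieces leaves
  the effective resistance equal to $|x-y|$, but admits indicators of pieces as functions of
  energy zero. Kigami's axiom that constants lie in the domain is not imposed, since it would
  force $M$ to be finite.
\<close>

locale resistance_space = dirichlet_form M D E
  for M :: "'a::metric_space measure" and D E +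
  assumes borel_measure: "sets M = sets borel"
    and dom_continuous: "\<And>u. u \<in> D \<Longrightarrow> \<exists>v. continuous_on UNIV v \<and> (AE x in M. u x = v x)"
    and dist_effective_resistance: "\<And>x y. ennreal (dist x y) = effective_resistance D E x y"

text \<open>
  An iterated integral, so that no \<open>\<sigma>\<close>-finiteness of \<open>M\<close> is needed for it to make sense.
\<close>

definition spatial_variance :: "'a::metric_space measure \<Rightarrow> real \<Rightarrow> ('a \<Rightarrow> real) \<Rightarrow> ennreal" where
  "spatial_variance M \<gamma> u =
     (\<integral>\<^sup>+ y. (\<integral>\<^sup>+ x. ennreal (dist x y powr \<gamma> * \<bar>u x\<bar>\<^sup>2 * \<bar>u y\<bar>\<^sup>2) \<partial>M) \<partial>M)"

end

theory Submission
  imports Defs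
begin

text \<open>
  In a resistance space a continuous function of finite energy satisfies
  $|u(x) - u(y)|^2 \le 4\, d(x,y)\, \mathcal{E}(u,u)$. Averaging over a ball of radius
  $\rho \sim (\mathcal{E}(u,u)+1)^{-1/(b+1)}$ and using the lower volume bound, a normalised $u$
  has $\sup |u|^2 \lesssim \rho^{-b}$. By the upper volume bound, the balls of radius
  $\varepsilon\rho$ then carry at most half of the mass of $|u|^2$ once $\varepsilon$ is small, so
  the spatial variance is at least
  $(\varepsilon\rho)^{b+1}/2 \sim (\mathcal{E}(u,u)+1)^{-1}$.
\<close>

text \<open>Let \<open>t\<close> tend to 0 from the right. This extracts the first-order condition
  from the one-sided variation in \<open>form_excess\<close>.\<close>

lemma nonneg_if_affine_nonneg:
  fixes a q :: real
  assumes "\<And>t. t > 0 \<Longrightarrow> 0 \<le> a + t * q"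
  shows "0 \<le> a"
proof -
  have "((\<lambda>t. a + t * q) \<longlongrightarrow> a + 0 * q) (at_right 0)"
    by (intro tendsto_intros)
  moreover have "\<forall>\<^sub>F t in at_right 0. 0 \<le> a + t * q"
    using assms by (auto intro: eventually_mono[OF eventually_at_right_less])
  ultimately show ?thesis
    using tendsto_lowerbound[of "\<lambda>t. a + t * q" "a + 0 * q" "at_right 0" 0] by simp
qed

section \<open>Bilinear algebra and truncation in a Dirichlet form\<close>

context dirichlet_form
begin

lemma form_scale_both:
  assumes "u \<in> D"
  shows "E (\<lambda>x. c * u x) (\<lambda>x. c * u x) = c\<^sup>2 * E u u"
proof -
  have "E (\<lambda>x. c * u x) (\<lambda>x. c * u x) = c * E u (\<lambda>x. c * u x)"
    using assms by (intro form_scale dom_scale)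
  also have "\<dots> = c * E (\<lambda>x. c * u x) u"
    using assms by (simp add: form_sym dom_scale)
  also have "\<dots> = c * (c * E u u)"
    using assms by (simp add: form_scale)
  finally show ?thesis by (simp add: power2_eq_square)
qed

lemma form_add_both:
  assumes "u \<in> D" "v \<in> D"
  shows "E (\<lambda>x. u x + v x) (\<lambda>x. u x + v x) = E u u + 2 * E u v + E v v"
proof -
  let ?s = "\<lambda>x. u x + v x"
  have s: "?s \<in> D" using assms by (rule dom_add)
  have "E ?s ?s = E u ?s + E v ?s" using assms s by (simp add: form_add)
  also have "\<dots> = E ?s u + E ?s v" using assms s by (simp add: form_sym)
  also have "\<dots> = E u u + E v u + (E u v + E v v)" using assms by (simp add: form_add)
  also have "E v u = E u v" by (rule form_sym[OF assms(2,1)])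
  finally show ?thesis by simp
qed

lemma form_uminus_both:
  assumes "u \<in> D"
  shows "(\<lambda>x. - u x) \<in> D" "E (\<lambda>x. - u x) (\<lambda>x. - u x) = E u u"
  using dom_scale[OF assms, of "-1"] form_scale_both[OF assms, of "-1"] by simp_all

lemma form_cong_AE_both:
  assumes "u \<in> D" "v \<in> D" "AE x in M. u x = v x"
  shows "E v v = E u u"
proof -
  have "E u u = E v u" using assms by (intro form_AE)
  also have "\<dots> = E u v" using assms by (intro form_sym)
  also have "\<dots> = E v v" using assms by (intro form_AE)
  finally show ?thesis ..
qed

text \<open>The Markov axiom truncates at height 1 only. Apply it to \<open>u / c\<close> and scale
  back: the form is homogeneous of degree two, so the factors in \<open>c\<close> cancel.\<close>

lemma form_clamp:
  assumes "u \<in> D" "c > 0"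
  shows "(\<lambda>x. min c (max 0 (u x))) \<in> D"
    and "E (\<lambda>x. min c (max 0 (u x))) (\<lambda>x. min c (max 0 (u x))) \<le> E u u"
proof -
  let ?v = "\<lambda>x. (1 / c) * u x"
  let ?f = "\<lambda>x. min 1 (max 0 (?v x))"
  have v: "?v \<in> D" using assms by (intro dom_scale)
  have f: "?f \<in> D" "E ?f ?f \<le> E ?v ?v" using form_markov[OF v] by blast+
  have eq: "(\<lambda>x. min c (max 0 (u x))) = (\<lambda>x. c * ?f x)"
    using assms(2) by (auto simp: fun_eq_iff min_def max_def field_simps)
  show "(\<lambda>x. min c (max 0 (u x))) \<in> D"
    unfolding eq by (rule dom_scale[OF f(1)])
  have "E (\<lambda>x. c * ?f x) (\<lambda>x. c * ?f x) = c\<^sup>2 * E ?f ?f"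
    by (rule form_scale_both[OF f(1)])
  also have "\<dots> \<le> c\<^sup>2 * E ?v ?v"
    using f(2) by (intro mult_left_mono) auto
  also have "E ?v ?v = (1 / c)\<^sup>2 * E u u"
    by (rule form_scale_both[OF assms(1)])
  also have "c\<^sup>2 * ((1 / c)\<^sup>2 * E u u) = E u u"
    using assms(2) by (simp add: power_divide)
  finally show "E (\<lambda>x. min c (max 0 (u x))) (\<lambda>x. min c (max 0 (u x))) \<le> E u u"
    unfolding eq .
qed

text \<open>A variational argument: with \<open>v\<close> the part of \<open>u\<close> below
  \<open>c\<close> and \<open>w\<close> the excess, truncating \<open>v + t * w\<close> at
  \<open>c\<close> gives back \<open>v\<close>, so the Markov property makes \<open>E v v\<close>
  minimal along this ray. Hence \<open>E v w\<close> is nonnegative, and expanding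
  \<open>E u u\<close> for \<open>u = v + w\<close> leaves at least \<open>E w w\<close>.\<close>

lemma form_excess:
  assumes "u \<in> D" "\<And>x. 0 \<le> u x" "0 \<le> c"
  shows "(\<lambda>x. u x - min c (u x)) \<in> D"
    and "E (\<lambda>x. u x - min c (u x)) (\<lambda>x. u x - min c (u x)) \<le> E u u"
proof -
  define v where "v = (\<lambda>x. min c (u x))"
  define w where "w = (\<lambda>x. u x - min c (u x))"
  have "w \<in> D \<and> E w w \<le> E u u"
  \<comment> \<open>\<open>form_clamp\<close> needs a positive height; at height 0 the excess is
    \<open>u\<close> itself.\<close>
  proof (cases "c = 0")
    case True
    then have "w = u" using assms(2) by (simp add: w_def)
    then show ?thesis using assms by simp
  next
    case False
    then have c: "c > 0" using assms(3) by simp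
    have "v = (\<lambda>x. min c (max 0 (u x)))"
      using assms(2) by (simp add: v_def max_absorb2)
    then have v: "v \<in> D" using form_clamp(1)[OF assms(1) c] by simp
    have w: "w \<in> D"
      using dom_add[OF assms(1) form_uminus_both(1)[OF v]] by (simp add: w_def v_def)
    have "0 \<le> 2 * E v w + t * E w w" if "t > 0" for t
    proof -
      let ?z = "\<lambda>x. v x + t * w x"
      have z: "?z \<in> D" using v w by (intro dom_add dom_scale)
      \<comment> \<open>Truncation at \<open>c\<close> does not see the excess, which lives where \<open>v = c\<close>.\<close>
      have "min c (max 0 (?z x)) = v x" for x
      proof (cases "u x \<le> c")
        case True
        then show ?thesis using assms(2)[of x] by (simp add: v_def w_def)
      next
        case False
        then have "c \<le> c + t * (u x - c)" using that by simp
        then show ?thesis using False c by (simp add: v_def w_def min_def max_def)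
      qed
      then have "E v v \<le> E ?z ?z"
        using form_clamp(2)[OF z c] by simp
      also have "\<dots> = E v v + 2 * E v (\<lambda>x. t * w x) + E (\<lambda>x. t * w x) (\<lambda>x. t * w x)"
        using v w by (intro form_add_both dom_scale)
      also have "E v (\<lambda>x. t * w x) = E (\<lambda>x. t * w x) v"
        using v w by (intro form_sym dom_scale)
      also have "\<dots> = t * E w v" using v w by (intro form_scale)
      also have "E w v = E v w" using v w by (intro form_sym)
      also have "E (\<lambda>x. t * w x) (\<lambda>x. t * w x) = t\<^sup>2 * E w w"
        using w by (rule form_scale_both)
      finally have "0 \<le> t * (2 * E v w + t * E w w)"
        by (simp add: algebra_simps power2_eq_square)
      then show ?thesis using that by (simp add: zero_le_mult_iff)
    qed
    then have "0 \<le> 2 * E v w" by (rule nonneg_if_affine_nonneg)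
    moreover have "E u u = E v v + 2 * E v w + E w w"
      using form_add_both[OF v w] by (simp add: v_def w_def)
    moreover have "0 \<le> E v v" using v by (rule form_nonneg)
    ultimately show ?thesis using w by simp
  qed
  then show "(\<lambda>x. u x - min c (u x)) \<in> D"
    and "E (\<lambda>x. u x - min c (u x)) (\<lambda>x. u x - min c (u x)) \<le> E u u"
    by (simp_all add: w_def)
qed

end

section \<open>Resistance estimates and the resulting pointwise bound\<close>

context resistance_space
begin

text \<open>If \<open>u x\<close> is nonzero, \<open>u / u x\<close> is a competitor in the supremum
  defining the effective resistance, and its energy is \<open>E u u / (u x)\<^sup>2\<close>.\<close>

lemma resistance_estimate_vanishing:
  assumes "u \<in> D" "continuous_on UNIV u" "u y = 0"
  shows "(u x)\<^sup>2 \<le> dist x y * E u u"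
proof (cases "u x = 0")
  case True
  then show ?thesis using form_nonneg[OF assms(1)] by simp
next
  case False
  let ?f = "\<lambda>z. (1 / u x) * u z"
  have f: "?f \<in> D" using assms(1) by (rule dom_scale)
  have Ef: "E ?f ?f = E u u / (u x)\<^sup>2"
    using form_scale_both[OF assms(1), of "1 / u x"] by (simp add: power_divide)
  have nn: "0 \<le> E ?f ?f" using f by (rule form_nonneg)
  have "continuous_on UNIV ?f" by (intro continuous_intros assms(2))
  then have "inverse (energy D E ?f) \<le> effective_resistance D E x y"
    unfolding effective_resistance_def using False assms(3) by (intro SUP_upper) simp
  then have le: "inverse (ennreal (E ?f ?f)) \<le> ennreal (dist x y)"
    using f by (simp add: dist_effective_resistance energy_def)
  \<comment> \<open>A competitor of energy zero would make the resistance infinite, whereas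
    \<open>dist x y\<close> is finite.\<close>
  have "E ?f ?f \<noteq> 0"
  proof
    assume "E ?f ?f = 0"
    then show False using le by (simp add: top_unique)
  qed
  then have pos: "0 < E ?f ?f" using nn by simp
  then have "inverse (E ?f ?f) \<le> dist x y"
    using le by (simp add: inverse_ennreal)
  then have "1 \<le> dist x y * E ?f ?f"
    using pos by (simp add: field_simps)
  then have "1 \<le> dist x y * E u u / (u x)\<^sup>2"
    unfolding Ef by simp
  then show ?thesis using False by (simp add: le_divide_eq)
qed

lemma resistance_estimate_nonneg:
  assumes "u \<in> D" "continuous_on UNIV u" "\<And>z. 0 \<le> u z"
  shows "(u x - u y)\<^sup>2 \<le> dist x y * E u u"
proof (induction "u y" "u x" arbitrary: x y rule: linorder_wlog)
  case le
  \<comment> \<open>By symmetry \<open>u y \<le> u x\<close>, so \<open>?w\<close> equals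
    \<open>u x - u y\<close> at \<open>x\<close> and 0 at \<open>y\<close>.\<close>
  let ?w = "\<lambda>z. u z - min (u y) (u z)"
  have "(?w x)\<^sup>2 \<le> dist x y * E ?w ?w"
    using form_excess(1)[OF assms(1,3,3)]
    by (intro resistance_estimate_vanishing continuous_intros assms(2)) simp_all
  also have "\<dots> \<le> dist x y * E u u"
    by (intro mult_left_mono form_excess(2)[OF assms(1,3,3)]) simp
  finally show ?case using le by simp
next
  case sym
  then show ?case by (simp add: power2_commute dist_commute)
qed

text \<open>
  The factor 4, which is not optimal, comes from treating positive and negative parts separately.
  They are cut off at a height irrelevant for \<open>x\<close> and \<open>y\<close>, because the Markov property is only
  available for bounded truncations.
\<close>

lemma resistance_estimate:
  assumes "u \<in> D" "continuous_on UNIV u"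
  shows "(u x - u y)\<^sup>2 \<le> 4 * dist x y * E u u"
proof -
  define c where "c = \<bar>u x\<bar> + \<bar>u y\<bar> + 1"
  have c: "c > 0" "\<bar>u x\<bar> \<le> c" "\<bar>u y\<bar> \<le> c" by (auto simp: c_def)
  define p where "p = (\<lambda>z. min c (max 0 (u z)))"
  define n where "n = (\<lambda>z. min c (max 0 (- u z)))"
  note neg = form_uminus_both[OF assms(1)]
  have p: "p \<in> D" "E p p \<le> E u u"
    using form_clamp[OF assms(1) c(1)] by (simp_all add: p_def)
  have n: "n \<in> D" "E n n \<le> E u u"
    using form_clamp[OF neg(1) c(1)] neg(2) by (simp_all add: n_def)
  have "(p x - p y)\<^sup>2 \<le> dist x y * E p p"
    using p(1) c(1) unfolding p_def
    by (intro resistance_estimate_nonneg continuous_intros assms(2)) auto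
  also have "\<dots> \<le> dist x y * E u u" using p(2) by (intro mult_left_mono) auto
  finally have P: "(p x - p y)\<^sup>2 \<le> dist x y * E u u" .
  have "(n x - n y)\<^sup>2 \<le> dist x y * E n n"
    using n(1) c(1) unfolding n_def
    by (intro resistance_estimate_nonneg continuous_intros assms(2)) auto
  also have "\<dots> \<le> dist x y * E u u" using n(2) by (intro mult_left_mono) auto
  finally have N: "(n x - n y)\<^sup>2 \<le> dist x y * E u u" .
  have "u x = p x - n x" "u y = p y - n y"
    using c by (auto simp: p_def n_def min_def max_def)
  then have "u x - u y = (p x - p y) - (n x - n y)" by simp
  then have "(u x - u y)\<^sup>2 = ((p x - p y) - (n x - n y))\<^sup>2" by (simp only:)
  also have "\<dots> \<le> 2 * (p x - p y)\<^sup>2 + 2 * (n x - n y)\<^sup>2"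
    using zero_le_power2[of "(p x - p y) + (n x - n y)"]
    by (simp add: power2_eq_square algebra_simps)
  finally show ?thesis using P N by simp
qed

text \<open>Bound \<open>(u x)\<^sup>2\<close> by \<open>2 * (u y)\<^sup>2\<close> plus twice the
  squared oscillation, apply the resistance estimate to the latter, and integrate over
  \<open>y\<close> in the ball. The total mass 1 then yields \<open>2 / m\<close>.\<close>

lemma pointwise_bound:
  assumes u: "u \<in> D" "continuous_on UNIV u" "(\<integral>\<^sup>+ y. ennreal ((u y)\<^sup>2) \<partial>M) = 1"
    and "r > 0" "m > 0" "ennreal m \<le> emeasure M (ball x r)"
  shows "(u x)\<^sup>2 \<le> 2 / m + 8 * r * E u u"
proof -
  have [measurable_cong]: "sets M = sets borel" by (rule borel_measure)
  have [measurable]: "u \<in> borel_measurable M"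
    using dom_square_integrable u(1) by (auto simp: square_integrable_def)
  \<comment> \<open>The 8 is the factor 4 of \<open>resistance_estimate\<close> times the 2 from
    splitting the square.\<close>
  define a where "a = (u x)\<^sup>2 - 8 * r * E u u"
  have nn: "0 \<le> E u u" using u(1) by (rule form_nonneg)
  have le: "a \<le> 2 * (u y)\<^sup>2" if "y \<in> ball x r" for y
  proof -
    have "(u x)\<^sup>2 \<le> 2 * (u y)\<^sup>2 + 2 * (u x - u y)\<^sup>2"
      using zero_le_power2[of "u x - 2 * u y"] by (simp add: power2_eq_square algebra_simps)
    moreover have "(u x - u y)\<^sup>2 \<le> 4 * dist x y * E u u"
      by (rule resistance_estimate[OF u(1,2)])
    moreover have "dist x y * E u u \<le> r * E u u"
      using that nn by (intro mult_right_mono) auto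
    ultimately show ?thesis by (simp add: a_def)
  qed
  have "a \<le> 2 / m"
  \<comment> \<open>\<open>ennreal\<close> sends negative reals to 0, so the product
    \<open>a * m\<close> splits safely only for nonnegative \<open>a\<close>.\<close>
  proof (cases "a \<le> 0")
    case True
    then show ?thesis using assms(5) by (smt (verit) divide_pos_pos)
  next
    case False
    have "ennreal (a * m) = ennreal a * ennreal m"
      using False assms(5) by (intro ennreal_mult) auto
    also have "\<dots> \<le> ennreal a * emeasure M (ball x r)"
      by (intro mult_left_mono assms) simp
    also have "\<dots> = (\<integral>\<^sup>+ y. ennreal a * indicator (ball x r) y \<partial>M)"
      by (rule nn_integral_cmult_indicator[symmetric]) (simp add: borel_measure)
    also have "\<dots> \<le> (\<integral>\<^sup>+ y. 2 * ennreal ((u y)\<^sup>2) \<partial>M)"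
    proof (intro nn_integral_mono)
      fix y
      have "ennreal a \<le> 2 * ennreal ((u y)\<^sup>2)" if "y \<in> ball x r"
        using ennreal_leI[OF le[OF that]] by (simp add: ennreal_mult)
      then show "ennreal a * indicator (ball x r) y \<le> 2 * ennreal ((u y)\<^sup>2)"
        by (auto simp: indicator_def)
    qed
    also have "\<dots> = ennreal 2" using u(3) by (simp add: nn_integral_cmult)
    finally have "a * m \<le> 2" by (subst (asm) ennreal_le_iff) auto
    then show ?thesis using assms(5) by (simp add: le_divide_eq)
  qed
  then show ?thesis by (simp add: a_def)
qed

end

section \<open>Spatial variance of functions that do not concentrate on small balls\<close>

lemma spatial_variance_cong_AE:
  assumes "AE x in M. u x = v x"
  shows "spatial_variance M \<gamma> u = spatial_variance M \<gamma> v"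
proof -
  have "(\<integral>\<^sup>+ x. ennreal (dist x y powr \<gamma> * \<bar>u x\<bar>\<^sup>2 * \<bar>u y\<bar>\<^sup>2) \<partial>M) =
        (\<integral>\<^sup>+ x. ennreal (dist x y powr \<gamma> * \<bar>v x\<bar>\<^sup>2 * \<bar>v y\<bar>\<^sup>2) \<partial>M)" if "u y = v y" for y
    using assms by (intro nn_integral_cong_AE, eventually_elim) (simp add: that)
  then show ?thesis
    unfolding spatial_variance_def using assms by (intro nn_integral_cong_AE) auto
qed

lemma nn_integral_square_if_l2_norm_1:
  assumes "l2_norm M u = 1"
  shows "u \<in> square_integrable M" "(\<integral>\<^sup>+ x. ennreal ((u x)\<^sup>2) \<partial>M) = 1"
proof -
  show u: "u \<in> square_integrable M"
    using assms by (auto simp: l2_norm_def split: if_splits)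
  then have "ennreal (sqrt (LINT x|M. (u x)\<^sup>2)) = ennreal 1"
    using assms by (simp add: l2_norm_def)
  then have "sqrt (LINT x|M. (u x)\<^sup>2) = 1"
    by (subst (asm) ennreal_inj) auto
  then have "(LINT x|M. (u x)\<^sup>2) = 1" by simp
  then show "(\<integral>\<^sup>+ x. ennreal ((u x)\<^sup>2) \<partial>M) = 1"
    using u by (subst nn_integral_eq_integral) (auto simp: square_integrable_def)
qed

text \<open>For each \<open>y\<close>, at least half of the mass lies outside the ball around
  \<open>y\<close>, where the kernel is at least \<open>s powr \<gamma>\<close>. Weighting by
  \<open>(u y)\<^sup>2\<close> and integrating in \<open>y\<close> contributes total mass 1.\<close>

lemma spatial_variance_lower_bound:
  fixes M :: "'a::metric_space measure"
  assumes borel: "sets M = sets borel" and [measurable]: "u \<in> borel_measurable M"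
    and norm: "(\<integral>\<^sup>+ x. ennreal ((u x)\<^sup>2) \<partial>M) = 1"
    and "s > 0" "\<gamma> \<ge> 0"
    and conc: "\<And>y. (\<integral>\<^sup>+ x\<in>ball y s. ennreal ((u x)\<^sup>2) \<partial>M) \<le> ennreal (1 / 2)"
  shows "ennreal (s powr \<gamma> / 2) \<le> spatial_variance M \<gamma> u"
proof -
  have [measurable_cong]: "sets M = sets borel" by (rule borel)
  have [measurable]: "ball y s \<in> sets M" for y by (simp add: borel)
  have far: "ennreal (1 / 2) \<le> (\<integral>\<^sup>+ x\<in>- ball y s. ennreal ((u x)\<^sup>2) \<partial>M)" for y
  proof -
    have "(\<integral>\<^sup>+ x. ennreal ((u x)\<^sup>2) \<partial>M) =
        (\<integral>\<^sup>+ x. ennreal ((u x)\<^sup>2) * indicator (ball y s) x +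
              ennreal ((u x)\<^sup>2) * indicator (- ball y s) x \<partial>M)"
      by (intro nn_integral_cong) (simp add: indicator_def)
    also have "\<dots> = (\<integral>\<^sup>+ x\<in>ball y s. ennreal ((u x)\<^sup>2) \<partial>M) +
        (\<integral>\<^sup>+ x\<in>- ball y s. ennreal ((u x)\<^sup>2) \<partial>M)"
      by (intro nn_integral_add) measurable
    also have "\<dots> \<le> ennreal (1 / 2) + (\<integral>\<^sup>+ x\<in>- ball y s. ennreal ((u x)\<^sup>2) \<partial>M)"
      by (rule add_right_mono[OF conc])
    also have "(\<integral>\<^sup>+ x. ennreal ((u x)\<^sup>2) \<partial>M) = ennreal (1 / 2) + ennreal (1 / 2)"
      by (simp add: norm ennreal_plus[symmetric] del: ennreal_half ennreal_plus)
    finally have "ennreal (1 / 2) + ennreal (1 / 2) \<le>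
        ennreal (1 / 2) + (\<integral>\<^sup>+ x\<in>- ball y s. ennreal ((u x)\<^sup>2) \<partial>M)" .
    then show ?thesis by (subst (asm) ennreal_add_left_cancel_le) auto
  qed
  have "ennreal (s powr \<gamma> / 2) = (\<integral>\<^sup>+ y. ennreal (s powr \<gamma> / 2) * ennreal ((u y)\<^sup>2) \<partial>M)"
    using norm by (simp add: nn_integral_cmult)
  also have "\<dots> \<le> spatial_variance M \<gamma> u"
    unfolding spatial_variance_def
  proof (intro nn_integral_mono)
    fix y
    have "ennreal (s powr \<gamma> / 2) * ennreal ((u y)\<^sup>2) =
        ennreal (s powr \<gamma> * (u y)\<^sup>2) * ennreal (1 / 2)"
      by (simp add: mult.commute del: ennreal_half flip: ennreal_mult)
    also have "\<dots> \<le> ennreal (s powr \<gamma> * (u y)\<^sup>2) * (\<integral>\<^sup>+ x\<in>- ball y s. ennreal ((u x)\<^sup>2) \<partial>M)"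
      by (intro mult_left_mono far) simp
    also have "\<dots> = (\<integral>\<^sup>+ x. ennreal (s powr \<gamma> * (u y)\<^sup>2) *
        (ennreal ((u x)\<^sup>2) * indicator (- ball y s) x) \<partial>M)"
      by (rule nn_integral_cmult[symmetric]) measurable
    also have "\<dots> \<le> (\<integral>\<^sup>+ x. ennreal (dist x y powr \<gamma> * \<bar>u x\<bar>\<^sup>2 * \<bar>u y\<bar>\<^sup>2) \<partial>M)"
    proof (intro nn_integral_mono)
      fix x
      have "s powr \<gamma> * (u y)\<^sup>2 * (u x)\<^sup>2 \<le> dist x y powr \<gamma> * \<bar>u x\<bar>\<^sup>2 * \<bar>u y\<bar>\<^sup>2" if "x \<notin> ball y s"
      proof -
        have "s powr \<gamma> \<le> dist x y powr \<gamma>"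
          using that assms(4,5) by (intro powr_mono2) (auto simp: dist_commute)
        then have "s powr \<gamma> * ((u y)\<^sup>2 * (u x)\<^sup>2) \<le> dist x y powr \<gamma> * ((u y)\<^sup>2 * (u x)\<^sup>2)"
          by (intro mult_right_mono) auto
        then show ?thesis by (simp add: mult_ac)
      qed
      then show "ennreal (s powr \<gamma> * (u y)\<^sup>2) * (ennreal ((u x)\<^sup>2) * indicator (- ball y s) x)
          \<le> ennreal (dist x y powr \<gamma> * \<bar>u x\<bar>\<^sup>2 * \<bar>u y\<bar>\<^sup>2)"
        by (auto simp: indicator_def ennreal_leI simp flip: ennreal_mult)
    qed
    finally show "ennreal (s powr \<gamma> / 2) * ennreal ((u y)\<^sup>2)
        \<le> (\<integral>\<^sup>+ x. ennreal (dist x y powr \<gamma> * \<bar>u x\<bar>\<^sup>2 * \<bar>u y\<bar>\<^sup>2) \<partial>M)" .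
  qed
  finally show ?thesis .
qed

section \<open>Choice of scales and the uncertainty inequality\<close>

theorem theorem2:
  fixes M :: "'a::metric_space measure"
    and D :: "('a \<Rightarrow> real) set"
    and E :: "('a \<Rightarrow> real) \<Rightarrow> ('a \<Rightarrow> real) \<Rightarrow> real"
    and b C\<^sub>0 C\<^sub>1 C\<^sub>2 \<gamma> :: real
  assumes "resistance_space M D E"
    and "b > 0" and "C\<^sub>0 > 0" and "C\<^sub>1 > 0" and "C\<^sub>2 > 0"
    and "\<And>x r. 0 < r \<Longrightarrow> r < C\<^sub>0 \<Longrightarrow>
           ennreal (C\<^sub>1 * r powr b) \<le> emeasure M (ball x r) \<and>
           emeasure M (ball x r) \<le> ennreal (C\<^sub>2 * r powr b)"
    and "\<gamma> = b + 1"
  shows "\<exists>C::real. C > 0 \<and>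
           (\<forall>u\<in>D. l2_norm M u = 1 \<longrightarrow>
              spatial_variance M \<gamma> u * (energy D E u + 1) \<ge> ennreal C)"
proof -
  interpret resistance_space M D E by (rule assms(1))
  note b = assms(2) and C0 = assms(3) and C1 = assms(4) and C2 = assms(5)
  \<comment> \<open>\<open>\<kappa>\<close> caps all radii strictly below \<open>C\<^sub>0\<close>.
    \<open>A\<close> is the constant in the bound \<open>A / \<rho> powr b\<close> for the square of
    the function: its summands come from the averaging and from the energy term.
    \<open>\<epsilon>\<close> makes \<open>C\<^sub>2 * A * \<epsilon> powr b\<close> at most 1/2,
    and the cap 1 keeps the shrunken radius below \<open>\<rho>\<close>.\<close>
  define \<kappa> where "\<kappa> = C\<^sub>0 / 2"
  define A where "A = 2 / C\<^sub>1 + 8 * \<kappa> powr (b + 1)"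
  define \<epsilon> where "\<epsilon> = min 1 ((1 / (2 * C\<^sub>2 * A)) powr (1 / b))"
  have \<kappa>: "0 < \<kappa>" "\<kappa> < C\<^sub>0" using C0 by (auto simp: \<kappa>_def)
  have A: "0 < A" using C1 \<kappa> by (auto simp: A_def intro!: add_pos_nonneg)
  have \<epsilon>: "0 < \<epsilon>" "\<epsilon> \<le> 1" using A C2 by (auto simp: \<epsilon>_def)
  have "\<epsilon> powr b \<le> ((1 / (2 * C\<^sub>2 * A)) powr (1 / b)) powr b"
    using b \<epsilon> by (intro powr_mono2) (auto simp: \<epsilon>_def)
  also have "\<dots> = 1 / (2 * C\<^sub>2 * A)"
    using b A C2 by (simp add: powr_powr)
  finally have \<epsilon>b: "C\<^sub>2 * A * \<epsilon> powr b \<le> 1 / 2"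
    using A C2 by (simp add: field_simps)
  define C where "C = (\<epsilon> * \<kappa>) powr (b + 1) / 2"
  have "C > 0" using \<epsilon> \<kappa> by (simp add: C_def)
  moreover have "ennreal C \<le> spatial_variance M \<gamma> u * (energy D E u + 1)"
    if u: "u \<in> D" "l2_norm M u = 1" for u
  proof -
    \<comment> \<open>The resistance estimate needs a continuous function; norm, energy and variance
      are unchanged on passing to this representative.\<close>
    obtain v where v: "continuous_on UNIV v" and uv: "AE x in M. u x = v x"
      using dom_continuous[OF u(1)] by blast
    have [measurable]: "v \<in> borel_measurable M"
      using borel_measurable_continuous_onI[OF v]
      by (simp add: measurable_cong_sets[OF borel_measure refl])
    have vD: "v \<in> D" using u(1) uv by (intro dom_AE[of u v]) auto
    have Ev: "E v v = E u u" using u(1) vD uv by (rule form_cong_AE_both)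
    have "(\<integral>\<^sup>+ x. ennreal ((v x)\<^sup>2) \<partial>M) = (\<integral>\<^sup>+ x. ennreal ((u x)\<^sup>2) \<partial>M)"
      using uv by (intro nn_integral_cong_AE) auto
    also have "\<dots> = 1" using u(2) by (rule nn_integral_square_if_l2_norm_1)
    finally have norm: "(\<integral>\<^sup>+ x. ennreal ((v x)\<^sup>2) \<partial>M) = 1" .
    define R where "R = E u u + 1"
    have nn: "0 \<le> E u u" using u(1) by (rule form_nonneg)
    then have R: "1 \<le> R" by (simp add: R_def)
    \<comment> \<open>This radius solves
      \<open>\<rho> powr (b + 1) * R = \<kappa> powr (b + 1)\<close>, so the energy term
      \<open>\<rho> * E u u\<close> is at most of the order \<open>\<rho> powr (- b)\<close> of the
      averaging term. Since \<open>R\<close> is at least 1, \<open>\<rho>\<close> does not exceed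
      \<open>\<kappa>\<close>.\<close>
    define \<rho> where "\<rho> = \<kappa> * R powr (- 1 / (b + 1))"
    have \<rho>0: "0 < \<rho>" using \<kappa> R by (simp add: \<rho>_def)
    have "R powr (- 1 / (b + 1)) \<le> 1 powr (- 1 / (b + 1))"
      using R b by (intro powr_mono2') auto
    then have "\<rho> \<le> \<kappa>" using \<kappa> by (simp add: \<rho>_def mult_le_cancel_left1)
    then have \<rho>C0: "\<rho> < C\<^sub>0" using \<kappa> by simp
    have "\<rho> powr (b + 1) = \<kappa> powr (b + 1) * R powr (- 1)"
      using R \<kappa> b by (simp add: \<rho>_def powr_mult powr_powr)
    then have \<rho>R: "\<rho> powr (b + 1) * R = \<kappa> powr (b + 1)"
      using R by (simp add: powr_minus)
    have "\<rho> * E u u * \<rho> powr b \<le> \<kappa> powr (b + 1)"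
    proof -
      have "\<rho> * E u u * \<rho> powr b = \<rho> powr (b + 1) * E u u"
        using \<rho>0 by (simp add: powr_add)
      also have "\<dots> \<le> \<rho> powr (b + 1) * R"
        by (intro mult_left_mono) (auto simp: R_def)
      finally show ?thesis using \<rho>R by simp
    qed
    then have \<rho>E: "\<rho> * E u u \<le> \<kappa> powr (b + 1) / \<rho> powr b"
      using \<rho>0 by (simp add: le_divide_eq)
    have sup: "(v x)\<^sup>2 \<le> A / \<rho> powr b" for x
    proof -
      have "(v x)\<^sup>2 \<le> 2 / (C\<^sub>1 * \<rho> powr b) + 8 * \<rho> * E v v"
        using \<rho>0 C1 assms(6)[OF \<rho>0 \<rho>C0] by (intro pointwise_bound vD v norm) auto
      also have "\<dots> \<le> 2 / (C\<^sub>1 * \<rho> powr b) + 8 * (\<kappa> powr (b + 1) / \<rho> powr b)"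
        using \<rho>E by (simp add: Ev)
      also have "\<dots> = A / \<rho> powr b" by (simp add: A_def add_divide_distrib)
      finally show ?thesis .
    qed
    define s where "s = \<epsilon> * \<rho>"
    have "0 < s" using \<epsilon> \<rho>0 by (simp add: s_def)
    moreover have "s \<le> \<rho>" using \<epsilon> \<rho>0 by (simp add: s_def mult_le_cancel_right1)
    ultimately have s: "0 < s" "s < C\<^sub>0" using \<rho>C0 by auto
    have conc: "(\<integral>\<^sup>+ x\<in>ball y s. ennreal ((v x)\<^sup>2) \<partial>M) \<le> ennreal (1 / 2)" for y
    proof -
      have "(\<integral>\<^sup>+ x\<in>ball y s. ennreal ((v x)\<^sup>2) \<partial>M) \<le>
          (\<integral>\<^sup>+ x\<in>ball y s. ennreal (A / \<rho> powr b) \<partial>M)"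
        using sup by (intro nn_integral_mono mult_right_mono ennreal_leI) auto
      also have "\<dots> = ennreal (A / \<rho> powr b) * emeasure M (ball y s)"
        by (rule nn_integral_cmult_indicator) (simp add: borel_measure)
      also have "\<dots> \<le> ennreal (A / \<rho> powr b) * ennreal (C\<^sub>2 * s powr b)"
        using assms(6)[OF s] by (intro mult_left_mono) auto
      also have "\<dots> = ennreal (A / \<rho> powr b * (C\<^sub>2 * s powr b))"
        using A C2 by (intro ennreal_mult[symmetric]) auto
      also have "A / \<rho> powr b * (C\<^sub>2 * s powr b) = C\<^sub>2 * A * \<epsilon> powr b"
        using \<epsilon> \<rho>0 by (simp add: s_def powr_mult)
      also have "ennreal \<dots> \<le> ennreal (1 / 2)" using \<epsilon>b by (rule ennreal_leI)
      finally show ?thesis .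
    qed
    \<comment> \<open>The exponent \<open>\<gamma> = b + 1\<close> is the one for which
      \<open>R\<close> cancels, leaving a constant independent of \<open>u\<close>.\<close>
    have "s powr \<gamma> * R = (\<epsilon> * \<kappa>) powr (b + 1)"
      using \<epsilon> \<rho>0 \<kappa> \<rho>R by (simp add: s_def assms(7) powr_mult mult.assoc)
    then have "ennreal C = ennreal (s powr \<gamma> / 2 * R)" by (simp add: C_def)
    also have "\<dots> = ennreal (s powr \<gamma> / 2) * ennreal R" using R by (intro ennreal_mult) auto
    also have "\<dots> \<le> spatial_variance M \<gamma> v * ennreal R"
      using s b assms(7)
      by (intro mult_right_mono spatial_variance_lower_bound[OF borel_measure _ norm _ _ conc]) auto
    also have "ennreal R = energy D E u + 1"
      using u(1) nn by (simp add: R_def energy_def ennreal_plus)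
    also have "spatial_variance M \<gamma> v = spatial_variance M \<gamma> u"
      using spatial_variance_cong_AE[OF uv] ..
    finally show ?thesis .
  qed
  ultimately show ?thesis by blast
qed

end
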